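(* Let $k\ge3$, let $\mathcal{H}$ be a connected $k$-uniform hypergraph on vertex set $[n]$, and let $b_i>0$ for each $i\in[n]$. For $i\in[n]$ put $$b'_i=b_i^{-(k-1)}\sum_{e\in E(\mathcal{H}),\, i\in e}\ \prod_{v\in e\setminus\{i\}} b_v ,\qquad g(i,j)=\frac{d_i+d_j+\sqrt{(d_i-d_j)^2+4b'_ib'_j}}{2}.$$ Then $$\min_{e\in E(\mathcal{H})}\min_{\{i,j\}\subseteq e}g(i,j)\le\rho(\mathbb{Q}(\mathcal{H}))\le\max_{e\in E(\mathcal{H})}\max_{\{i,j\}\subseteq e}g(i,j).$$ Moreover, one of these equalities holds if and only if $d_i+b'_i=d_j+b'_j$ for all $i,j\in[n]$.
   Context: A $k$-uniform hypergraph $\mathcal{H}$ has vertex set $[n]$ and edge set $E(\mathcal{H})$ of $k$-element subsets of $[n]$; $d_i$ is the number of edges containing vertex $i$. It is connected if any two vertices are joined by a walk $v_0,e_1,v_1,\ldots,e_\ell,v_\ell$ with $\{v_i,v_{i+1}\}\subseteq e_{i+1}$. The adjacency tensor $\mathbb{A}(\mathcal{H})$ is the order $k$ dimension $n$ tensor with entry $\frac{1}{(k-1)!}$ at $(i_1,\ldots,i_k)$ if $\{i_1,\ldots,i_k\}\in E(\mathcal{H})$ and $0$ otherwise. The signless Laplacian tensor is $\mathbb{Q}(\mathcal{H})=\mathbb{D}(\mathcal{H})+\mathbb{A}(\mathcal{H})$, where $\mathbb{D}(\mathcal{H})$ is the order $k$ dimension $n$ diagonal tensor with entry $d_i$ at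 $(i,\ldots,i)$. For an order $k$ dimension $n$ tensor $\mathbb{T}$, $\lambda\in\mathbb{C}$ is an eigenvalue if there is nonzero $X\in\mathbb{C}^n$ with $\sum_{i_2,\ldots,i_k}t_{ii_2\ldots i_k}x_{i_2}\cdots x_{i_k}=\lambda x_i^{k-1}$ for all $i$; $\rho(\mathbb{T})$ is the maximum modulus of eigenvalues. *)

theory Defs
  imports Complex_Main
begin

definition uniform_hypergraph :: "nat \<Rightarrow> nat \<Rightarrow> nat set set \<Rightarrow> bool" where
  "uniform_hypergraph k n E \<longleftrightarrow> (\<forall>e\<in>E. e \<subseteq> {1..n} \<and> card e = k)"

definition vertex_degree :: "nat set set \<Rightarrow> nat \<Rightarrow> nat" where
  "vertex_degree E i = card {e \<in> E. i \<in> e}"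

text \<open>The walk \<open>v\<^sub>0, e\<^sub>1, v\<^sub>1, \<dots>, e\<^sub>l, v\<^sub>l\<close> is given by its list \<open>vs\<close> of \<open>l + 1\<close> vertices and its
  list \<open>es\<close> of \<open>l\<close> edges, so that \<open>es ! m\<close> is \<open>e\<^sub>m\<^sub>+\<^sub>1\<close>.\<close>

definition is_walk :: "nat \<Rightarrow> nat set set \<Rightarrow> nat list \<Rightarrow> nat set list \<Rightarrow> bool" where
  "is_walk n E vs es \<longleftrightarrow>
     length vs = length es + 1 \<and> set vs \<subseteq> {1..n} \<and> set es \<subseteq> E \<and>
     (\<forall>m<length es. {vs ! m, vs ! (m + 1)} \<subseteq> es ! m)"

definition connected_hypergraph :: "nat \<Rightarrow> nat set set \<Rightarrow> bool" where
  "connected_hypergraph n E \<longleftrightarrow>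
     (\<forall>u\<in>{1..n}. \<forall>v\<in>{1..n}. \<exists>vs es. is_walk n E vs es \<and> hd vs = u \<and> last vs = v)"

text \<open>A tensor of order \<open>k\<close> and dimension \<open>n\<close> is a function on index lists; only its values on
  lists of length \<open>k\<close> over \<open>{1..n}\<close> matter. Likewise only the coordinates in \<open>{1..n}\<close> of a vector
  of dimension \<open>n\<close> matter.\<close>

type_synonym tensor = "nat list \<Rightarrow> complex"

definition adjacency_tensor :: "nat \<Rightarrow> nat set set \<Rightarrow> tensor" where
  "adjacency_tensor k E = (\<lambda>is. if set is \<in> E then 1 / fact (k - 1) else 0)"

definition degree_tensor :: "nat \<Rightarrow> nat set set \<Rightarrow> tensor" where
  "degree_tensor k E = (\<lambda>is. if is = replicate k (hd is) then of_nat (vertex_degree E (hd is)) else 0)"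

definition signless_laplacian_tensor :: "nat \<Rightarrow> nat set set \<Rightarrow> tensor" where
  "signless_laplacian_tensor k E = (\<lambda>is. degree_tensor k E is + adjacency_tensor k E is)"

definition tensor_eigenvalue :: "nat \<Rightarrow> nat \<Rightarrow> tensor \<Rightarrow> complex \<Rightarrow> bool" where
  "tensor_eigenvalue k n T lam \<longleftrightarrow>
     (\<exists>x :: nat \<Rightarrow> complex. (\<exists>i\<in>{1..n}. x i \<noteq> 0) \<and>
       (\<forall>i\<in>{1..n}.
         (\<Sum>js | length js = k - 1 \<and> set js \<subseteq> {1..n}. T (i # js) * (\<Prod>j\<leftarrow>js. x j))
           = lam * x i ^ (k - 1)))"

text \<open>\<open>GREATEST\<close> rather than \<open>Max\<close>, since \<open>Max\<close> is unspecified unless the set of moduli is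
  already known to be finite.\<close>

definition tensor_spectral_radius :: "nat \<Rightarrow> nat \<Rightarrow> tensor \<Rightarrow> real" where
  "tensor_spectral_radius k n T = (GREATEST r. \<exists>lam. tensor_eigenvalue k n T lam \<and> r = cmod lam)"

definition b_prime :: "nat \<Rightarrow> nat set set \<Rightarrow> (nat \<Rightarrow> real) \<Rightarrow> nat \<Rightarrow> real" where
  "b_prime k E b i = (\<Sum>e | e \<in> E \<and> i \<in> e. \<Prod>v\<in>e - {i}. b v) / b i ^ (k - 1)"

definition g_pair :: "nat \<Rightarrow> nat set set \<Rightarrow> (nat \<Rightarrow> real) \<Rightarrow> nat \<Rightarrow> nat \<Rightarrow> real" where
  "g_pair k E b i j =
     (real (vertex_degree E i) + real (vertex_degree E j)
       + sqrt ((real (vertex_degree E i) - real (vertex_degree E j))\<^sup>2 + 4 * b_prime k E b i * b_prime k E b j)) / 2"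

definition vertex_pairs :: "nat set \<Rightarrow> (nat \<times> nat) set" where
  "vertex_pairs e = {(i, j). i \<noteq> j \<and> {i, j} \<subseteq> e}"

end

theory Submission
  imports Defs "HOL-Analysis.Function_Topology" "HOL-Combinatorics.Multiset_Permutations"
begin

text \<open>Minimising \<open>max\<^sub>i (d\<^sub>i + b'\<^sub>i(x))\<close> over positive vectors \<open>x\<close> yields a positive eigenvector \<open>x\<close> of
  the signless Laplacian tensor, whose eigenvalue \<open>\<rho>\<close> is then the spectral radius. Put
  \<open>y = x / b\<close>, let \<open>i\<close> maximise \<open>y\<close> and let \<open>j\<close> maximise \<open>y\<close> among the neighbours of \<open>i\<close>. The
  eigenvalue equations at \<open>i\<close> and \<open>j\<close> give \<open>(\<rho> - d\<^sub>i) y\<^sub>i\<^bsup>k-1\<^esup> \<le> b'\<^sub>i y\<^sub>j\<^bsup>k-1\<^esup>\<close> and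
  \<open>(\<rho> - d\<^sub>j) y\<^sub>j\<^bsup>k-1\<^esup> \<le> b'\<^sub>j y\<^sub>i\<^bsup>k-1\<^esup>\<close>; their product says \<open>\<rho> \<le> g(i,j)\<close>. In case of equality all
  neighbours of \<open>i\<close> have the value \<open>y\<^sub>j\<close> and all neighbours of \<open>j\<close> the value \<open>y\<^sub>i\<close>; as \<open>k \<ge> 3\<close>, a
  third vertex of an edge through \<open>i\<close> and \<open>j\<close> shows that the two values agree, and connectedness
  makes \<open>y\<close> constant. The lower bound is dual.\<close>

text \<open>The off-diagonal part of the tensor equation at \<open>i\<close>. It is kept polymorphic
  to serve complex eigenvectors as well as real positive ones.\<close>

definition edge_sum :: "nat set set \<Rightarrow> (nat \<Rightarrow> 'a::comm_semiring_1) \<Rightarrow> nat \<Rightarrow> 'a" where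
  "edge_sum E x i = (\<Sum>e | e \<in> E \<and> i \<in> e. \<Prod>v\<in>e - {i}. x v)"

lemma b_prime_edge_sum: "b_prime k E b i = edge_sum E b i / b i ^ (k - 1)"
  by (simp add: b_prime_def edge_sum_def)

text \<open>A single vertex without edges also counts as connected, so \<open>nonempty\<close> is a
  separate assumption; with it every vertex lies on an edge.\<close>

locale connected_uniform_hypergraph =
  fixes k n :: nat and E :: "nat set set"
  assumes k_ge: "k \<ge> 3"
    and uniform: "uniform_hypergraph k n E"
    and connected: "connected_hypergraph n E"
    and nonempty: "E \<noteq> {}"
begin

section \<open>Edges, vertices and walks\<close>

lemma edge_subset: "e \<in> E \<Longrightarrow> e \<subseteq> {1..n}"
  and card_edge: "e \<in> E \<Longrightarrow> card e = k"
  using uniform by (auto simp: uniform_hypergraph_def)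

lemma edge_vertex: "e \<in> E \<Longrightarrow> v \<in> e \<Longrightarrow> v \<in> {1..n}"
  using edge_subset by blast

lemma finite_edge: "e \<in> E \<Longrightarrow> finite e"
  using edge_subset finite_subset by blast

lemma finite_edges: "finite E"
  using edge_subset by (meson PowI finite_Pow_iff finite_atLeastAtMost finite_subset subsetI)

lemma card_edge_remove: "e \<in> E \<Longrightarrow> i \<in> e \<Longrightarrow> card (e - {i}) = k - 1"
  using card_edge finite_edge by (simp add: card_Diff_singleton)

text \<open>All uses of connectedness go through this rule, which follows a walk from
  \<open>u\<close> to \<open>v\<close> by induction on the position.\<close>

lemma edge_induct:
  assumes "u \<in> {1..n}" "P u" "v \<in> {1..n}"
    and step: "\<And>e i j. e \<in> E \<Longrightarrow> i \<in> e \<Longrightarrow> j \<in> e \<Longrightarrow> P i \<Longrightarrow> P j"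
  shows "P v"
proof -
  obtain vs es where w: "is_walk n E vs es" "hd vs = u" "last vs = v"
    using connected assms(1,3) unfolding connected_hypergraph_def by blast
  have len: "length vs = length es + 1" and es: "set es \<subseteq> E"
    and inc: "\<And>m. m < length es \<Longrightarrow> {vs ! m, vs ! (m + 1)} \<subseteq> es ! m"
    using w(1) by (auto simp: is_walk_def)
  have "P (vs ! m)" if "m \<le> length es" for m
    using that
  proof (induction m)
    case 0
    then show ?case using w(2) assms(2) len by (metis hd_conv_nth length_0_conv add_is_0 one_neq_zero)
  next
    case (Suc m)
    then show ?case using step[of "es ! m" "vs ! m" "vs ! Suc m"] inc[of m] subsetD[OF es nth_mem[of m]]
      by (auto simp: Suc_le_eq)
  qed
  from this[of "length es"] show ?thesis
    using w(3) len by (metis add_diff_cancel_right' last_conv_nth length_0_conv add_is_0 one_neq_zero order_refl)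
qed

text \<open>Three vertices cannot fit into \<open>{i, j}\<close>. Since \<open>i\<close> and
  \<open>j\<close> are arbitrary and may coincide, this also yields a first or a second vertex of an
  edge.\<close>

lemma other_vertex_in_edge:
  assumes "e \<in> E" obtains v where "v \<in> e" "v \<noteq> i" "v \<noteq> j"
proof -
  have "card {i, j} < card e"
    using k_ge card_edge[OF assms] by (cases "i = j") auto
  then have "\<not> e \<subseteq> {i, j}"
    by (meson card_mono finite.emptyI finite.insertI not_less)
  then show ?thesis using that by blast
qed

lemma vertex_in_edge:
  assumes "i \<in> {1..n}" obtains e where "e \<in> E" "i \<in> e"
proof -
  obtain e0 where e0: "e0 \<in> E" using nonempty by blast
  obtain u where u: "u \<in> e0" using other_vertex_in_edge[OF e0] by blast
  have "\<exists>e\<in>E. i \<in> e"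
    by (rule edge_induct[of u "\<lambda>i. \<exists>e\<in>E. i \<in> e" i]) (use e0 u edge_subset assms in blast)+
  then show ?thesis using that by blast
qed

lemma n_pos: "{1..n} \<noteq> {}"
  using nonempty edge_subset card_edge k_ge by fastforce

section \<open>The tensor equation as a sum over edges\<close>

text \<open>The diagonal tensor contributes only the constant index list. An edge \<open>e\<close>
  through \<open>i\<close> is met by the \<open>(k - 1)!\<close> orderings of
  \<open>e - {i}\<close>, which cancel the factor \<open>1 / fact (k - 1)\<close>.\<close>

lemma tensor_apply:
  fixes x :: "nat \<Rightarrow> complex"
  assumes i: "i \<in> {1..n}"
  shows "(\<Sum>js | length js = k - 1 \<and> set js \<subseteq> {1..n}.
            signless_laplacian_tensor k E (i # js) * (\<Prod>j\<leftarrow>js. x j))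
         = of_nat (vertex_degree E i) * x i ^ (k - 1) + edge_sum E x i"
proof -
  define J where "J = {js. length js = k - 1 \<and> set js \<subseteq> {1..n}}"
  have finJ: "finite J"
    using finite_lists_length_eq[of "{1..n}" "k - 1"] by (simp add: J_def conj_commute)
  have rep: "replicate k i = i # replicate (k - 1) i"
    using k_ge by (cases k) auto
  have "(\<Sum>js\<in>J. degree_tensor k E (i # js) * (\<Prod>j\<leftarrow>js. x j))
      = (\<Sum>js\<in>J. if js = replicate (k - 1) i then of_nat (vertex_degree E i) * x i ^ (k - 1) else 0)"
    by (rule sum.cong) (auto simp: degree_tensor_def rep prod_list_replicate)
  also have "\<dots> = of_nat (vertex_degree E i) * x i ^ (k - 1)"
    using i finJ by (simp add: J_def set_replicate_conv_if)
  finally have deg: "(\<Sum>js\<in>J. degree_tensor k E (i # js) * (\<Prod>j\<leftarrow>js. x j))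
      = of_nat (vertex_degree E i) * x i ^ (k - 1)" .
  define I where "I = {e \<in> E. i \<in> e}"
  have finI: "finite I" using finite_edges by (simp add: I_def)
  \<comment> \<open>With only \<open>k - 1\<close> entries, \<open>js\<close> can complete
    \<open>i\<close> to an edge of \<open>k\<close> vertices only if it avoids \<open>i\<close> and
    repeats nothing.\<close>
  have lists_of_edge: "{js \<in> J. set (i # js) = e} = permutations_of_set (e - {i})" if "e \<in> I" for e
  proof -
    have e: "e \<in> E" "i \<in> e" using that by (auto simp: I_def)
    note c = card_edge_remove[OF e] card_edge[OF e(1)] finite_edge[OF e(1)] edge_subset[OF e(1)]
    have "set js = e - {i} \<and> distinct js" if js: "js \<in> J" "insert i (set js) = e" for js
    proof -
      have l: "card (set js) \<le> k - 1" using js(1) card_length[of js] by (simp add: J_def)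
      have "i \<notin> set js"
      proof
        assume "i \<in> set js"
        then have "set js = e" using js(2) by auto
        then show False using l c(2) k_ge by auto
      qed
      then have "set js = e - {i}" using js(2) by auto
      moreover have "distinct js"
        using calculation c(1) js(1) by (intro card_distinct) (simp add: J_def)
      ultimately show ?thesis by simp
    qed
    moreover have "js \<in> J \<and> insert i (set js) = e" if js: "set js = e - {i}" "distinct js" for js
    proof -
      have "length js = k - 1" using distinct_card[OF js(2)] c(1) js(1) by simp
      moreover have "set js \<subseteq> {1..n}" using js(1) c(4) by blast
      ultimately show ?thesis using js(1) e(2) by (simp add: J_def insert_absorb)
    qed
    ultimately show ?thesis unfolding permutations_of_set_def list.set by blast
  qed
  \<comment> \<open>The membership test becomes a sum over the edges through \<open>i\<close>, at
    most one of which matches, so that the two sums can be swapped.\<close>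
  have "(\<Sum>js\<in>J. adjacency_tensor k E (i # js) * (\<Prod>j\<leftarrow>js. x j))
      = (\<Sum>js\<in>J. \<Sum>e\<in>I. if set (i # js) = e then (\<Prod>j\<leftarrow>js. x j) / fact (k - 1) else 0)"
    using finI by (intro sum.cong) (auto simp: adjacency_tensor_def I_def)
  also have "\<dots> = (\<Sum>e\<in>I. \<Sum>js\<in>J. if set (i # js) = e then (\<Prod>j\<leftarrow>js. x j) / fact (k - 1) else 0)"
    by (rule sum.swap)
  also have "\<dots> = (\<Sum>e\<in>I. \<Sum>js\<in>permutations_of_set (e - {i}). (\<Prod>j\<leftarrow>js. x j) / fact (k - 1))"
    by (rule sum.cong[OF refl], subst lists_of_edge[symmetric], assumption)
       (rule sum.inter_filter[OF finJ, symmetric])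
  also have "\<dots> = (\<Sum>e\<in>I. \<Prod>v\<in>e - {i}. x v)"
  proof (rule sum.cong[OF refl])
    fix e assume "e \<in> I"
    then have e: "e \<in> E" "i \<in> e" by (auto simp: I_def)
    have "(\<Sum>js\<in>permutations_of_set (e - {i}). (\<Prod>j\<leftarrow>js. x j) / fact (k - 1))
        = (\<Sum>js\<in>permutations_of_set (e - {i}). (\<Prod>v\<in>e - {i}. x v) / fact (k - 1))"
      by (rule sum.cong) (simp_all add: permutations_of_set_def prod.distinct_set_conv_list[symmetric])
    also have "\<dots> = (\<Prod>v\<in>e - {i}. x v)"
      using card_permutations_of_set[of "e - {i}"] card_edge_remove[OF e] finite_edge[OF e(1)] by simp
    finally show "(\<Sum>js\<in>permutations_of_set (e - {i}). (\<Prod>j\<leftarrow>js. x j) / fact (k - 1))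
        = (\<Prod>v\<in>e - {i}. x v)" .
  qed
  finally show ?thesis
    using deg by (simp add: signless_laplacian_tensor_def distrib_right sum.distrib J_def edge_sum_def I_def)
qed

section \<open>Positive vectors and the spectral radius\<close>

definition positive :: "(nat \<Rightarrow> real) \<Rightarrow> bool" where
  "positive x \<longleftrightarrow> (\<forall>i\<in>{1..n}. 0 < x i)"

lemma positiveD: "positive x \<Longrightarrow> i \<in> {1..n} \<Longrightarrow> 0 < x i"
  by (simp add: positive_def)

lemma edge_sum_scale: "edge_sum E (\<lambda>v. t * x v) i = t ^ (k - 1) * edge_sum E x i"
  unfolding edge_sum_def sum_distrib_left
  by (rule sum.cong) (auto simp: prod.distrib card_edge_remove simp del: card_Diff_insert card_Diff_singleton)

lemma edge_sum_cong:
  assumes "\<And>v. v \<in> {1..n} \<Longrightarrow> x v = y v" shows "edge_sum E x i = edge_sum E y i"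
  unfolding edge_sum_def
  by (intro sum.cong prod.cong refl assms) (auto dest: edge_vertex)

lemma edge_sum_mono:
  assumes "\<And>v. v \<in> {1..n} \<Longrightarrow> 0 \<le> x v \<and> x v \<le> (y v :: real)"
  shows "edge_sum E x i \<le> edge_sum E y i"
  unfolding edge_sum_def
  by (intro sum_mono prod_mono assms) (auto dest: edge_vertex)

lemma edge_prod_pos: "positive x \<Longrightarrow> e \<in> E \<Longrightarrow> 0 < (\<Prod>v\<in>e - {i}. x v)"
  by (intro prod_pos) (auto dest: edge_vertex intro: positiveD)

lemma edge_prod_le_edge_sum:
  assumes "positive x" "e \<in> E" "i \<in> e"
  shows "(\<Prod>v\<in>e - {i}. x v) \<le> edge_sum E x i"
  unfolding edge_sum_def
  by (rule member_le_sum[of e]) (use assms finite_edges edge_prod_pos in \<open>auto intro: less_imp_le\<close>)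

lemma edge_sum_pos:
  assumes "positive x" "i \<in> {1..n}" shows "0 < edge_sum E x i"
  by (rule vertex_in_edge[OF assms(2)])
     (use assms edge_prod_pos edge_prod_le_edge_sum in \<open>force intro: less_le_trans\<close>)

lemma b_prime_pos: "positive x \<Longrightarrow> i \<in> {1..n} \<Longrightarrow> 0 < b_prime k E x i"
  by (simp add: b_prime_edge_sum edge_sum_pos positiveD)

lemma b_prime_scale: "t \<noteq> 0 \<Longrightarrow> b_prime k E (\<lambda>v. t * x v) i = b_prime k E x i"
  by (simp add: b_prime_edge_sum edge_sum_scale power_mult_distrib)

lemma b_prime_cong:
  assumes "\<And>v. v \<in> {1..n} \<Longrightarrow> x v = y v" "i \<in> {1..n}" shows "b_prime k E x i = b_prime k E y i"
  using edge_sum_cong[of x y i] assms by (simp add: b_prime_edge_sum)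

text \<open>The vector \<open>x\<close> is itself an eigenvector for \<open>r\<close>. Given another
  eigenvector \<open>y\<close>, the least multiple \<open>t * x\<close> that dominates the moduli of
  \<open>y\<close> touches them at some \<open>i\<close>; the triangle inequality in row
  \<open>i\<close> then bounds the modulus of its eigenvalue by \<open>r\<close>.\<close>

lemma spectral_radius_eq:
  assumes x: "positive x"
    and eig: "\<And>i. i \<in> {1..n} \<Longrightarrow> real (vertex_degree E i) + b_prime k E x i = r"
  shows "tensor_spectral_radius k n (signless_laplacian_tensor k E) = r"
proof -
  have eq: "real (vertex_degree E i) * x i ^ (k - 1) + edge_sum E x i = r * x i ^ (k - 1)"
    if "i \<in> {1..n}" for i
    using eig[OF that] positiveD[OF x that] by (simp add: b_prime_edge_sum field_simps)
  show ?thesis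
    unfolding tensor_spectral_radius_def
  proof (rule Greatest_equality)
    obtain i0 where i0: "i0 \<in> {1..n}" using n_pos by blast
    have r: "r \<ge> 0" using eig[OF i0] b_prime_pos[OF x i0] by linarith
    have "tensor_eigenvalue k n (signless_laplacian_tensor k E) (of_real r)"
      unfolding tensor_eigenvalue_def
    proof (intro exI[of _ "\<lambda>i. of_real (x i)"] conjI ballI bexI[OF _ i0])
      show "complex_of_real (x i0) \<noteq> 0" using positiveD[OF x i0] by simp
      fix i assume i: "i \<in> {1..n}"
      have "edge_sum E (\<lambda>i. complex_of_real (x i)) i = of_real (edge_sum E x i)"
        by (simp add: edge_sum_def)
      then show "(\<Sum>js | length js = k - 1 \<and> set js \<subseteq> {1..n}.
              signless_laplacian_tensor k E (i # js) * (\<Prod>j\<leftarrow>js. complex_of_real (x j)))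
           = of_real r * of_real (x i) ^ (k - 1)"
        unfolding tensor_apply[OF i] using arg_cong[OF eq[OF i], of complex_of_real] by simp
    qed
    then show "\<exists>lam. tensor_eigenvalue k n (signless_laplacian_tensor k E) lam \<and> r = cmod lam"
      using r by (intro exI[of _ "of_real r"]) simp
  next
    fix s assume "\<exists>lam. tensor_eigenvalue k n (signless_laplacian_tensor k E) lam \<and> s = cmod lam"
    then obtain lam y where s: "s = cmod lam" and ne: "\<exists>i\<in>{1..n}. y i \<noteq> 0"
      and y: "\<And>i. i \<in> {1..n} \<Longrightarrow>
        of_nat (vertex_degree E i) * y i ^ (k - 1) + edge_sum E y i = lam * y i ^ (k - 1)"
      unfolding tensor_eigenvalue_def using tensor_apply by (metis (no_types, lifting))
    define t where "t = Max ((\<lambda>i. cmod (y i) / x i) ` {1..n})"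
    have "t \<in> (\<lambda>i. cmod (y i) / x i) ` {1..n}"
      unfolding t_def using n_pos by (intro Max_in) auto
    then obtain i where i: "i \<in> {1..n}" and ti: "t = cmod (y i) / x i" by blast
    have le: "cmod (y v) \<le> t * x v" if "v \<in> {1..n}" for v
    proof -
      have "cmod (y v) / x v \<le> t" unfolding t_def using that by (intro Max_ge) auto
      then show ?thesis using positiveD[OF x that] by (simp add: field_simps)
    qed
    have yi: "cmod (y i) = t * x i" using ti positiveD[OF x i] by simp
    obtain v where v: "v \<in> {1..n}" "y v \<noteq> 0" using ne by blast
    have "t > 0"
      using le[OF v(1)] v positiveD[OF x v(1)]
      by (smt (verit) zero_less_norm_iff mult_nonpos_nonneg)
    have "s * cmod (y i) ^ (k - 1) = cmod (of_nat (vertex_degree E i) * y i ^ (k - 1) + edge_sum E y i)"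
      unfolding y[OF i] by (simp add: s norm_mult norm_power)
    also have "\<dots> \<le> real (vertex_degree E i) * cmod (y i) ^ (k - 1) + cmod (edge_sum E y i)"
      by (rule order_trans[OF norm_triangle_ineq]) (simp add: norm_mult norm_power)
    also have "cmod (edge_sum E y i) \<le> edge_sum E (\<lambda>v. cmod (y v)) i"
      unfolding edge_sum_def by (rule order_trans[OF norm_sum]) (simp add: prod_norm)
    also have "\<dots> \<le> edge_sum E (\<lambda>v. t * x v) i"
      by (rule edge_sum_mono) (simp add: le)
    also have "\<dots> = t ^ (k - 1) * edge_sum E x i" by (rule edge_sum_scale)
    finally have "s * (t ^ (k - 1) * x i ^ (k - 1)) \<le> t ^ (k - 1) * (real (vertex_degree E i) * x i ^ (k - 1) + edge_sum E x i)"
      by (simp add: yi power_mult_distrib algebra_simps)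
    then have "s * (t ^ (k - 1) * x i ^ (k - 1)) \<le> r * (t ^ (k - 1) * x i ^ (k - 1))"
      unfolding eq[OF i] by (simp add: mult_ac)
    then show "s \<le> r"
      using \<open>t > 0\<close> positiveD[OF x i] by simp
  qed
qed

section \<open>Row sums and the positive eigenvector\<close>

text \<open>For positive \<open>x\<close> this is the left side of the eigenvalue equation at
  \<open>i\<close> divided by \<open>x i ^ (k - 1)\<close>, so \<open>x\<close> is an eigenvector
  exactly when all rows agree.\<close>

definition row_sum :: "(nat \<Rightarrow> real) \<Rightarrow> nat \<Rightarrow> real" where
  "row_sum x i = real (vertex_degree E i) + b_prime k E x i"

text \<open>The upper Collatz-Wielandt function.\<close>

definition max_row_sum :: "(nat \<Rightarrow> real) \<Rightarrow> real" where
  "max_row_sum x = Max (row_sum x ` {1..n})"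

lemma row_sum_le_max: "i \<in> {1..n} \<Longrightarrow> row_sum x i \<le> max_row_sum x"
  unfolding max_row_sum_def by (intro Max_ge) auto

lemma max_row_sum_attained: obtains i where "i \<in> {1..n}" "row_sum x i = max_row_sum x"
proof -
  have "max_row_sum x \<in> row_sum x ` {1..n}"
    unfolding max_row_sum_def using n_pos by (intro Max_in) auto
  then show ?thesis using that by auto
qed

text \<open>If \<open>x\<close> is smallest on the edge \<open>e\<close> at \<open>i\<close>, then the term of \<open>e\<close> in row \<open>i\<close> is at least
  \<open>x u / x i\<close> for every other \<open>u\<close> in \<open>e\<close>; so bounded row sums bound the ratios along edges.\<close>

lemma edge_ratio_bound:
  assumes x: "positive x" and M: "max_row_sum x \<le> M" and e: "e \<in> E" "u \<in> e" "v \<in> e" and "M \<ge> 1"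
  shows "x u \<le> M * x v"
proof -
  have fin: "finite (x ` e)" "x ` e \<noteq> {}" using finite_edge e by auto
  obtain i where i: "i \<in> e" and xi: "x i = Min (x ` e)"
    using Min_in[OF fin] by auto
  have min: "x i \<le> x w" if "w \<in> e" for w
    unfolding xi using fin that by (intro Min_le) auto
  have en: "w \<in> {1..n}" if "w \<in> e" for w using edge_subset e that by blast
  have pos: "x w > 0" if "w \<in> e" for w using positiveD[OF x en[OF that]] .
  have "x u \<le> M * x i"
  proof (cases "u = i")
    case True
    then show ?thesis using \<open>M \<ge> 1\<close> pos[OF i] by simp
  next
    case False
    \<comment> \<open>The \<open>k - 1\<close> factors in the term of \<open>e\<close> are
      \<open>x u\<close> and \<open>m\<close> others, each at least \<open>x i\<close>.\<close>
    obtain m where m: "k = Suc (Suc m)"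
      using k_ge that[of "k - 2"] by simp
    have "x u * x i ^ m = x u * (\<Prod>w\<in>e - {i} - {u}. x i)"
      using card_edge_remove[OF e(1) i] finite_edge[OF e(1)] False e by (simp add: m card_Diff_singleton)
    also have "\<dots> \<le> x u * (\<Prod>w\<in>e - {i} - {u}. x w)"
      using pos[OF e(2)] by (intro mult_left_mono prod_mono) (auto intro: min less_imp_le[OF pos[OF i]])
    also have "\<dots> = (\<Prod>w\<in>e - {i}. x w)"
      using finite_edge[OF e(1)] False e by (intro prod.remove[symmetric]) auto
    also have "\<dots> \<le> edge_sum E x i"
      by (rule edge_prod_le_edge_sum[OF x e(1) i])
    also have "\<dots> = b_prime k E x i * x i ^ (k - 1)"
      using pos[OF i] by (simp add: b_prime_edge_sum)
    also have "\<dots> \<le> M * x i ^ (k - 1)"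
      using row_sum_le_max[OF en[OF i], of x] M pos[OF i]
      by (intro mult_right_mono) (auto simp: row_sum_def)
    also have "\<dots> = (M * x i) * x i ^ m" by (simp add: m)
    finally show ?thesis using pos[OF i] by simp
  qed
  also have "\<dots> \<le> M * x v" using min[OF e(3)] \<open>M \<ge> 1\<close> by simp
  finally show ?thesis .
qed

text \<open>The edge bound is chained along walks, losing a factor \<open>M\<close> per edge, and
  the least constant over the finitely many pairs is taken. That \<open>m\<close> does not depend on
  \<open>x\<close> is what makes the search for a minimiser compact.\<close>

lemma ratio_bound:
  assumes "M \<ge> 1"
  obtains m where "m > 0" "\<And>x u v. positive x \<Longrightarrow> max_row_sum x \<le> M \<Longrightarrow> u \<in> {1..n} \<Longrightarrow> v \<in> {1..n} \<Longrightarrow>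
    m * x u \<le> x v"
proof -
  have "\<exists>c>0. \<forall>x. positive x \<longrightarrow> max_row_sum x \<le> M \<longrightarrow> c * x u \<le> x v"
    if u: "u \<in> {1..n}" and v: "v \<in> {1..n}" for u v
  proof (rule edge_induct[of u _ v])
    show "\<exists>c>0. \<forall>x. positive x \<longrightarrow> max_row_sum x \<le> M \<longrightarrow> c * x u \<le> x u"
      by (rule exI[of _ 1]) simp
    fix e i j
    assume e: "e \<in> E" "i \<in> e" "j \<in> e"
      and "\<exists>c>0. \<forall>x. positive x \<longrightarrow> max_row_sum x \<le> M \<longrightarrow> c * x u \<le> x i"
    then obtain c where c: "c > 0" "\<And>x. positive x \<Longrightarrow> max_row_sum x \<le> M \<Longrightarrow> c * x u \<le> x i"
      by blast
    show "\<exists>c>0. \<forall>x. positive x \<longrightarrow> max_row_sum x \<le> M \<longrightarrow> c * x u \<le> x j"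
    proof (intro exI[of _ "c / M"] conjI allI impI)
      show "c / M > 0" using c(1) assms by simp
      fix x assume x: "positive x" "max_row_sum x \<le> M"
      have "c * x u \<le> M * x j"
        using c(2)[OF x] edge_ratio_bound[OF x e assms] by linarith
      then show "c / M * x u \<le> x j" using assms by (simp add: field_simps)
    qed
  qed (use u v in auto)
  then obtain c where c: "\<And>u v. u \<in> {1..n} \<Longrightarrow> v \<in> {1..n} \<Longrightarrow> c u v > 0 \<and>
      (\<forall>x. positive x \<longrightarrow> max_row_sum x \<le> M \<longrightarrow> c u v * x u \<le> x v)" by metis
  define C where "C = (\<lambda>(u, v). c u v) ` ({1..n} \<times> {1..n})"
  have C: "finite C" "C \<noteq> {}" using n_pos by (auto simp: C_def)
  show ?thesis
  proof (rule that)
    show "Min C > 0" using Min_in[OF C] c by (auto simp: C_def)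
    fix x u v assume *: "positive x" "max_row_sum x \<le> M" "u \<in> {1..n}" "v \<in> {1..n}"
    have "Min C \<le> c u v" using * C by (intro Min_le) (auto simp: C_def)
    then have "Min C * x u \<le> c u v * x u"
      using positiveD[OF *(1,3)] by (intro mult_right_mono) auto
    also have "\<dots> \<le> x v" using c * by blast
    finally show "Min C * x u \<le> x v" .
  qed
qed

end

lemma continuous_on_Max_image:
  fixes f :: "'i \<Rightarrow> 'a::topological_space \<Rightarrow> real"
  assumes "finite I" "I \<noteq> {}" "\<And>i. i \<in> I \<Longrightarrow> continuous_on S (f i)"
  shows "continuous_on S (\<lambda>x. Max ((\<lambda>i. f i x) ` I))"
  using assms
proof (induction I rule: finite_ne_induct)
  case (insert i I)
  then have "continuous_on S (\<lambda>x. max (f i x) (Max ((\<lambda>i. f i x) ` I)))"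
    by (intro continuous_on_max) auto
  then show ?case using insert by simp
qed simp

context connected_uniform_hypergraph
begin

text \<open>Row sums are invariant under scaling, so a competitor may be normalised to largest entry
  1. By \<open>ratio_bound\<close> it then lies in a compact box, on which the continuous
  \<open>max_row_sum\<close> attains its minimum.\<close>

lemma max_row_sum_minimiser:
  obtains x where "positive x" "\<And>z. positive z \<Longrightarrow> max_row_sum x \<le> max_row_sum z"
proof -
  let ?one = "\<lambda>_::nat. 1 :: real"
  have one: "positive ?one" by (simp add: positive_def)
  \<comment> \<open>A vector whose largest row sum exceeds \<open>M\<close> is already beaten by the
    constant vector; the bound 1 is what \<open>ratio_bound\<close> asks for.\<close>
  define M where "M = max 1 (max_row_sum ?one)"
  obtain m where m: "m > 0" and ratio: "\<And>x u v. positive x \<Longrightarrow> max_row_sum x \<le> M \<Longrightarrow>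
      u \<in> {1..n} \<Longrightarrow> v \<in> {1..n} \<Longrightarrow> m * x u \<le> x v"
    using ratio_bound[of M] by (auto simp: M_def)
  obtain i0 where i0: "i0 \<in> {1..n}" using n_pos by blast
  have m1: "m \<le> 1" using ratio[OF one _ i0 i0] by (simp add: M_def)
  \<comment> \<open>Coordinates outside \<open>{1..n}\<close> are pinned to 1, which makes the box
    compact in the space of all functions on \<open>nat\<close>.\<close>
  define K where "K = (\<Pi>\<^sub>E i\<in>UNIV. if i \<in> {1..n} then {m..1} else {1::real})"
  have "compactin (product_topology (\<lambda>i. euclidean) UNIV) K"
    unfolding K_def by (subst compactin_PiE) (auto simp: m1)
  then have K: "compact K" by (simp add: euclidean_product_topology)
  have oneK: "?one \<in> K" using m1 by (auto simp: K_def)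
  have Kpos: "positive x" if "x \<in> K" for x
    unfolding positive_def
  proof
    fix i assume "i \<in> {1..n}"
    then have "x i \<in> {m..1}" using PiE_mem[OF that[unfolded K_def], of i] by simp
    then show "0 < x i" using m by simp
  qed
  have coord: "continuous_on K (\<lambda>x. x i)" for i
    by (rule continuous_on_product_then_coordinatewise) (rule continuous_on_id)
  have "continuous_on K max_row_sum"
    unfolding max_row_sum_def row_sum_def b_prime_edge_sum edge_sum_def
    by (intro continuous_on_Max_image continuous_intros coord)
       (use n_pos Kpos in \<open>fastforce dest: positiveD\<close>)+
  then obtain x where x: "x \<in> K" "\<And>z. z \<in> K \<Longrightarrow> max_row_sum x \<le> max_row_sum z"
    using continuous_attains_inf[OF K] oneK by blast
  show ?thesis
  proof (rule that[OF Kpos[OF x(1)]])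
    fix z assume z: "positive z"
    show "max_row_sum x \<le> max_row_sum z"
    proof (cases "max_row_sum z \<le> M")
      case False
      then have "max_row_sum ?one \<le> max_row_sum z" by (simp add: M_def)
      then show ?thesis using x(2)[OF oneK] by linarith
    next
      case True
      have "Max (z ` {1..n}) \<in> z ` {1..n}"
        using n_pos by (intro Max_in) auto
      then obtain u where u: "u \<in> {1..n}" "z u = Max (z ` {1..n})" by (elim imageE) (rule that; simp)
      have zu: "z v \<le> z u" if "v \<in> {1..n}" for v
        unfolding u(2) using that by (intro Max_ge) auto
      have pu: "z u > 0" using positiveD[OF z u(1)] .
      define w where "w = (\<lambda>v. if v \<in> {1..n} then inverse (z u) * z v else 1)"
      have "w \<in> K"
        using zu ratio[OF z True u(1)] pu by (auto simp: w_def K_def field_simps)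
      moreover have "b_prime k E w i = b_prime k E z i" if i: "i \<in> {1..n}" for i
      proof -
        have "b_prime k E w i = b_prime k E (\<lambda>v. inverse (z u) * z v) i"
          by (rule b_prime_cong[OF _ i]) (simp add: w_def)
        then show ?thesis using pu by (simp add: b_prime_scale)
      qed
      then have "max_row_sum w = max_row_sum z"
        unfolding max_row_sum_def row_sum_def by (intro arg_cong[of _ _ Max] image_cong) auto
      ultimately show ?thesis using x(2)[of w] by simp
    qed
  qed
qed

text \<open>A minimiser of the largest row sum with as few maximal rows as possible has all rows maximal:
  otherwise slightly decreasing \<open>x j\<close>, where row \<open>j\<close> is not maximal but shares an edge with a
  maximal row, keeps row \<open>j\<close> below the maximum and strictly decreases the other row.\<close>

lemma perron_vector:
  obtains x r where "positive x" "\<And>i. i \<in> {1..n} \<Longrightarrow> row_sum x i = r"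
proof -
  define opt where "opt x \<longleftrightarrow> positive x \<and> (\<forall>z. positive z \<longrightarrow> max_row_sum x \<le> max_row_sum z)" for x
  define S where "S x = {i \<in> {1..n}. row_sum x i = max_row_sum x}" for x
  obtain x0 where "opt x0" using max_row_sum_minimiser by (auto simp: opt_def)
  then obtain x where x: "opt x" and least: "\<And>z. opt z \<Longrightarrow> card (S x) \<le> card (S z)"
    using ex_has_least_nat[of opt x0 "\<lambda>x. card (S x)"] by blast
  have px: "positive x" using x by (simp add: opt_def)
  let ?r = "max_row_sum x"
  show ?thesis
  proof (rule that[OF px], rule ccontr)
    fix v assume v: "v \<in> {1..n}" "row_sum x v \<noteq> ?r"
    obtain u where u: "u \<in> {1..n}" "row_sum x u = ?r" by (rule max_row_sum_attained)
    have "\<exists>e\<in>E. \<exists>i\<in>e. \<exists>j\<in>e. row_sum x i = ?r \<and> row_sum x j \<noteq> ?r"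
      using edge_induct[of u "\<lambda>i. row_sum x i = ?r" v] u v by blast
    then obtain e i j where e: "e \<in> E" "i \<in> e" "j \<in> e" and ri: "row_sum x i = ?r"
      and rj: "row_sum x j \<noteq> ?r" by blast
    have ij: "i \<in> {1..n}" "j \<in> {1..n}" "i \<noteq> j" using edge_vertex e ri rj by auto
    let ?B = "b_prime k E x j" and ?d = "real (vertex_degree E j)"
    have Bpos: "?B > 0" using b_prime_pos[OF px ij(2)] .
    have less: "?B < ?r - ?d"
      using rj row_sum_le_max[OF ij(2), of x] by (simp add: row_sum_def)
    \<comment> \<open>The midpoint between the ratio and 1: dividing \<open>?B\<close> by
      \<open>q\<close> still leaves row \<open>j\<close> strictly below the maximum.\<close>
    define q where "q = (1 + ?B / (?r - ?d)) / 2"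
    have ratio: "0 < ?B / (?r - ?d)" "?B / (?r - ?d) < 1" using Bpos less by auto
    then have q: "0 < q" "q < 1" by (auto simp: q_def)
    have "?B / (?r - ?d) < q" using ratio(2) unfolding q_def by argo
    then have qB: "?B / q < ?r - ?d" using q(1) Bpos less by (simp add: field_simps)
    \<comment> \<open>Row \<open>j\<close> depends on \<open>x j\<close> only through the
      denominator \<open>x j ^ (k - 1)\<close>, so scaling \<open>x j\<close> by this root divides
      \<open>?B\<close> by exactly \<open>q\<close>.\<close>
    define t where "t = root (k - 1) q"
    have k1: "k - 1 > 0" using k_ge by simp
    have t: "0 < t" "t < 1" "t ^ (k - 1) = q"
      using q k1 by (auto simp: t_def)
    define z where "z = x(j := t * x j)"
    have z_le: "z v \<le> x v" if "v \<in> {1..n}" for v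
      using t positiveD[OF px ij(2)] by (simp add: z_def)
    have pz: "positive z" using px t ij by (auto simp: positive_def z_def)
    have "edge_sum E z j = edge_sum E x j"
      unfolding edge_sum_def by (intro sum.cong prod.cong) (auto simp: z_def)
    then have zj: "row_sum z j < ?r"
      using qB t(3) by (simp add: row_sum_def b_prime_edge_sum z_def power_mult_distrib field_simps)
    have sum_le: "edge_sum E z v \<le> edge_sum E x v" for v
      by (rule edge_sum_mono) (use z_le pz in \<open>auto intro: less_imp_le dest: positiveD\<close>)
    have row_le: "row_sum z v \<le> row_sum x v" if "v \<in> {1..n}" "v \<noteq> j" for v
      using sum_le[of v] positiveD[OF px that(1)] that(2)
      by (simp add: row_sum_def b_prime_edge_sum z_def divide_right_mono)
    have "edge_sum E z i < edge_sum E x i"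
      unfolding edge_sum_def
    proof (rule sum_strict_mono_ex1)
      show "finite {e \<in> E. i \<in> e}" using finite_edges by simp
      show "\<forall>e\<in>{e \<in> E. i \<in> e}. (\<Prod>v\<in>e - {i}. z v) \<le> (\<Prod>v\<in>e - {i}. x v)"
        using z_le pz by (auto intro!: prod_mono intro: less_imp_le positiveD dest: edge_vertex)
      have fe: "finite (e - {i})" "j \<in> e - {i}" using finite_edge e ij by auto
      have "(\<Prod>v\<in>e - {i}. z v) = t * (\<Prod>v\<in>e - {i}. x v)"
        unfolding prod.remove[OF fe] by (simp add: z_def)
      then have "(\<Prod>v\<in>e - {i}. z v) < (\<Prod>v\<in>e - {i}. x v)"
        using t edge_prod_pos[OF px e(1), of i] by simp
      then show "\<exists>e\<in>{e \<in> E. i \<in> e}. (\<Prod>v\<in>e - {i}. z v) < (\<Prod>v\<in>e - {i}. x v)"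
        using e by blast
    qed
    then have zi: "row_sum z i < ?r"
      using ri positiveD[OF px ij(1)] ij(3)
      by (simp add: row_sum_def b_prime_edge_sum z_def divide_strict_right_mono flip: ri)
    have z_top: "row_sum z v \<le> ?r" if "v \<in> {1..n}" for v
      using row_le[OF that] zj row_sum_le_max[OF that, of x] by (cases "v = j") auto
    have "max_row_sum z \<le> ?r"
      using max_row_sum_attained[of z] z_top by metis
    then have eq: "max_row_sum z = ?r" using x pz by (auto simp: opt_def intro: antisym)
    then have "opt z" using x pz by (simp add: opt_def)
    have "S z \<subset> S x"
    proof
      show "S z \<subseteq> S x"
      proof
        fix v assume "v \<in> S z"
        then have v: "v \<in> {1..n}" "row_sum z v = ?r" by (auto simp: S_def eq)
        then have "v \<noteq> j" using zj by auto
        then have "row_sum x v = ?r" using row_le[OF v(1)] v row_sum_le_max[OF v(1), of x] by auto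
        then show "v \<in> S x" using v by (simp add: S_def)
      qed
      have "i \<in> S x" "i \<notin> S z" using zi ri ij(1) by (auto simp: S_def eq)
      then show "S z \<noteq> S x" by blast
    qed
    moreover have "finite (S x)" by (simp add: S_def)
    ultimately have "card (S z) < card (S x)" by (intro psubset_card_mono)
    then show False using least[OF \<open>opt z\<close>] by simp
  qed
qed

end

section \<open>Signed comparison of the eigenvector with \<open>b\<close>\<close>

text \<open>The sign \<open>s\<close> treats both bounds at once: \<open>s = 1\<close> gives the upper one, \<open>s = -1\<close> the lower one.\<close>

lemma signed_prod_bound:
  fixes f :: "'a \<Rightarrow> real"
  assumes "finite A" "m > 0" "s = 1 \<or> s = - 1"
    and f: "\<And>v. v \<in> A \<Longrightarrow> 0 < f v \<and> s * f v \<le> s * m"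
  shows "s * prod f A \<le> s * m ^ card A"
    and "s * prod f A = s * m ^ card A \<Longrightarrow> v \<in> A \<Longrightarrow> f v = m"
proof -
  \<comment> \<open>Subsets are needed because the equality case splits off one factor and bounds
    the product of the rest.\<close>
  have bound: "s * prod f B \<le> s * m ^ card B" if "B \<subseteq> A" for B
  proof (cases "s = 1")
    case True
    have "prod f B \<le> (\<Prod>v\<in>B. m)"
      using f that True by (intro prod_mono) (force intro: less_imp_le)
    then show ?thesis using True by simp
  next
    case False
    then have s: "s = - 1" using assms(3) by simp
    have "(\<Prod>v\<in>B. m) \<le> prod f B"
      using f that s assms(2) by (intro prod_mono) force
    then show ?thesis using s by simp
  qed
  then show "s * prod f A \<le> s * m ^ card A" by simp
  assume eq: "s * prod f A = s * m ^ card A" and v: "v \<in> A"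
  have card: "card A = Suc (card (A - {v}))" using card_Suc_Diff1[OF assms(1) v] by simp
  have "m * (s * m ^ card (A - {v})) = f v * (s * prod f (A - {v}))"
    using eq unfolding prod.remove[OF assms(1) v] card power_Suc by (simp only: mult_ac)
  also have "\<dots> \<le> f v * (s * m ^ card (A - {v}))"
    using f[OF v] by (intro mult_left_mono bound) auto
  finally have "(s * m) * m ^ card (A - {v}) \<le> (s * f v) * m ^ card (A - {v})"
    by (simp add: mult_ac)
  then have "s * m \<le> s * f v"
    by (rule mult_right_le_imp_le) (use assms(2) in simp)
  with f[OF v] have "s * m = s * f v" by linarith
  then show "f v = m" using assms(3) by auto
qed

text \<open>The expression with the square root is the larger root of
  \<open>(X - a) * (X - c) = p\<close>. As \<open>2 * r - a - c\<close> is positive, both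
  comparisons follow by squaring.\<close>

lemma larger_root_iff:
  fixes r a c p :: real
  assumes "a < r" "c < r" "p \<ge> 0"
  shows "r \<le> (a + c + sqrt ((a - c)\<^sup>2 + 4 * p)) / 2 \<longleftrightarrow> (r - a) * (r - c) \<le> p"
    and "(a + c + sqrt ((a - c)\<^sup>2 + 4 * p)) / 2 \<le> r \<longleftrightarrow> p \<le> (r - a) * (r - c)"
proof -
  let ?D = "(a - c)\<^sup>2 + 4 * p"
  have sq: "(2 * r - a - c)\<^sup>2 = (a - c)\<^sup>2 + 4 * ((r - a) * (r - c))"
    by (simp add: power2_eq_square algebra_simps)
  have pos: "0 \<le> 2 * r - a - c" using assms by simp
  have "r \<le> (a + c + sqrt ?D) / 2 \<longleftrightarrow> 2 * r - a - c \<le> sqrt ?D" by auto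
  also have "\<dots> \<longleftrightarrow> (2 * r - a - c)\<^sup>2 \<le> ?D"
    using pos real_sqrt_le_iff[of "(2 * r - a - c)\<^sup>2" ?D] by simp
  finally show "r \<le> (a + c + sqrt ?D) / 2 \<longleftrightarrow> (r - a) * (r - c) \<le> p"
    unfolding sq by simp
  have "(a + c + sqrt ?D) / 2 \<le> r \<longleftrightarrow> sqrt ?D \<le> 2 * r - a - c" by auto
  also have "\<dots> \<longleftrightarrow> ?D \<le> (2 * r - a - c)\<^sup>2"
    using pos real_sqrt_le_iff[of ?D "(2 * r - a - c)\<^sup>2"] by simp
  finally show "(a + c + sqrt ?D) / 2 \<le> r \<longleftrightarrow> p \<le> (r - a) * (r - c)"
    unfolding sq by simp
qed

text \<open>One factor is exchanged at a time, passing through \<open>u * q\<close>; in the equality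
  case both exchanges are equalities.\<close>

lemma signed_mult_mono:
  fixes p q u w :: real
  assumes "s = 1 \<or> s = - 1" "0 < p" "0 < q" "0 < u" "0 < w" "s * p \<le> s * u" "s * q \<le> s * w"
  shows "s * (p * q) \<le> s * (u * w)"
    and "s * (u * w) \<le> s * (p * q) \<Longrightarrow> p = u \<and> q = w"
proof -
  have "s * (p * q) \<le> s * (u * q)" "s * (u * q) \<le> s * (u * w)"
    using mult_right_mono[OF assms(6), of q] mult_right_mono[OF assms(7), of u] assms(3,4)
    by (simp_all add: mult_ac)
  then show "s * (p * q) \<le> s * (u * w)" by linarith
  assume "s * (u * w) \<le> s * (p * q)"
  then have "s * (p * q) = s * (u * q)" "s * (u * q) = s * (u * w)"
    using \<open>s * (p * q) \<le> s * (u * q)\<close> \<open>s * (u * q) \<le> s * (u * w)\<close> by linarith+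
  then show "p = u \<and> q = w" using assms(1-5) by auto
qed

context connected_uniform_hypergraph
begin

text \<open>The products of \<open>b\<close> act as positive weights on the products of
  \<open>y\<close>, each of which compares with \<open>m ^ (k - 1)\<close>. Equality of the sums
  forces equality in every term, and then in every factor.\<close>

lemma signed_edge_sum_bound:
  assumes b: "positive b" and y: "positive y" and "m > 0" and s: "s = 1 \<or> s = - 1"
    and le: "\<And>e v. e \<in> E \<Longrightarrow> i \<in> e \<Longrightarrow> v \<in> e - {i} \<Longrightarrow> s * y v \<le> s * m"
  shows "s * edge_sum E (\<lambda>v. b v * y v) i \<le> s * (m ^ (k - 1) * edge_sum E b i)"
    and "edge_sum E (\<lambda>v. b v * y v) i = m ^ (k - 1) * edge_sum E b i \<Longrightarrow>
      e \<in> E \<Longrightarrow> i \<in> e \<Longrightarrow> v \<in> e - {i} \<Longrightarrow> y v = m"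
proof -
  let ?I = "{e \<in> E. i \<in> e}"
  have fin: "finite ?I" using finite_edges by simp
  have lhs: "s * edge_sum E (\<lambda>v. b v * y v) i
      = (\<Sum>e\<in>?I. (\<Prod>v\<in>e - {i}. b v) * (s * (\<Prod>v\<in>e - {i}. y v)))"
    by (simp add: edge_sum_def sum_distrib_left prod.distrib mult_ac)
  have rhs: "s * (m ^ (k - 1) * edge_sum E b i)
      = (\<Sum>e\<in>?I. (\<Prod>v\<in>e - {i}. b v) * (s * m ^ (k - 1)))"
    by (simp add: edge_sum_def sum_distrib_left mult_ac)
  have yle: "0 < y v \<and> s * y v \<le> s * m" if "e \<in> ?I" "v \<in> e - {i}" for e v
    using that le positiveD[OF y edge_vertex] by auto
  have fe: "finite (e - {i})" "card (e - {i}) = k - 1" if "e \<in> ?I" for e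
    using that finite_edge card_edge_remove by auto
  have bound: "s * (\<Prod>v\<in>e - {i}. y v) \<le> s * m ^ (k - 1)" if "e \<in> ?I" for e
    using signed_prod_bound(1)[OF fe(1)[OF that] \<open>m > 0\<close> s yle[OF that]] fe(2)[OF that] by simp
  have summand_le: "(\<Prod>v\<in>e - {i}. b v) * (s * (\<Prod>v\<in>e - {i}. y v)) \<le> (\<Prod>v\<in>e - {i}. b v) * (s * m ^ (k - 1))"
    if "e \<in> ?I" for e
    using edge_prod_pos[OF b, of e i] that by (intro mult_left_mono bound) (auto intro: less_imp_le)
  show "s * edge_sum E (\<lambda>v. b v * y v) i \<le> s * (m ^ (k - 1) * edge_sum E b i)"
    unfolding lhs rhs by (intro sum_mono summand_le)
  assume "edge_sum E (\<lambda>v. b v * y v) i = m ^ (k - 1) * edge_sum E b i" and e: "e \<in> E" "i \<in> e"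
    and v: "v \<in> e - {i}"
  then have "(\<Sum>e\<in>?I. (\<Prod>v\<in>e - {i}. b v) * (s * (\<Prod>v\<in>e - {i}. y v)))
      = (\<Sum>e\<in>?I. (\<Prod>v\<in>e - {i}. b v) * (s * m ^ (k - 1)))"
    using lhs rhs by simp
  from sum_mono_inv[OF this summand_le _ fin, of e]
  have "(\<Prod>v\<in>e - {i}. b v) * (s * (\<Prod>v\<in>e - {i}. y v)) = (\<Prod>v\<in>e - {i}. b v) * (s * m ^ (k - 1))"
    using e by simp
  then have "s * (\<Prod>v\<in>e - {i}. y v) = s * m ^ card (e - {i})"
    using edge_prod_pos[OF b e(1), of i] fe(2)[of e] e by simp
  then show "y v = m"
    using e by (intro signed_prod_bound(2)[OF fe(1) \<open>m > 0\<close> s yle _ v]) auto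
qed

text \<open>The local form of the argument, at any vertex \<open>i\<close> where
  \<open>s * (x i / b i)\<close> is largest. The equality clause concerns all edges through
  \<open>i\<close>, so it can be reapplied wherever extremality has spread.\<close>

lemma extremal_vertex:
  assumes x: "positive x" and r: "\<And>i. i \<in> {1..n} \<Longrightarrow> row_sum x i = r"
    and b: "positive b" and s: "s = 1 \<or> s = - 1"
    and i: "i \<in> {1..n}" and ext: "\<And>v. v \<in> {1..n} \<Longrightarrow> s * (x v / b v) \<le> s * (x i / b i)"
  obtains e j where "e \<in> E" "i \<in> e" "j \<in> e" "i \<noteq> j"
    and "s * r \<le> s * g_pair k E b i j"
    and "s * g_pair k E b i j \<le> s * r \<Longrightarrow> e' \<in> E \<Longrightarrow> i \<in> e' \<Longrightarrow> v \<in> e' \<Longrightarrow> x v / b v = x i / b i"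
proof -
  define y where "y v = x v / b v" for v
  have y: "positive y" using x b by (simp add: positive_def y_def)
  define N where "N = \<Union>{e \<in> E. i \<in> e} - {i}"
  have finN: "finite N" unfolding N_def using finite_edges finite_edge by (intro finite_Diff finite_Union) auto
  have "N \<noteq> {}"
  proof -
    obtain e where e: "e \<in> E" "i \<in> e" using vertex_in_edge[OF i] .
    obtain v where "v \<in> e" "v \<noteq> i" using other_vertex_in_edge[OF e(1)] by metis
    then show ?thesis using e by (auto simp: N_def)
  qed
  then have "Max ((\<lambda>v. s * y v) ` N) \<in> (\<lambda>v. s * y v) ` N" using finN by (intro Max_in) auto
  \<comment> \<open>For \<open>s = - 1\<close> this selects the neighbour of \<open>i\<close> with
    the smallest value of \<open>y\<close>.\<close>
  then obtain j where j: "j \<in> N" "s * y j = Max ((\<lambda>v. s * y v) ` N)" by (elim imageE) (rule that; simp only:)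
  have jmax: "s * y v \<le> s * y j" if "v \<in> N" for v
    unfolding j(2) using finN that by (intro Max_ge) auto
  obtain e where e: "e \<in> E" "i \<in> e" "j \<in> e" "i \<noteq> j" using j(1) by (auto simp: N_def)
  have jn: "j \<in> {1..n}" using edge_vertex[OF e(1,3)] .
  let ?d = "\<lambda>v. real (vertex_degree E v)" and ?B = "b_prime k E b"
  have gap: "r - ?d v = b_prime k E x v" if "v \<in> {1..n}" for v
    using r[OF that] by (simp add: row_sum_def)
  have pos: "0 < r - ?d v" "0 < ?B v" "0 < y v" if "v \<in> {1..n}" for v
    using gap[OF that] b_prime_pos[OF x that] b_prime_pos[OF b that] positiveD[OF y that] by auto
  have xy: "edge_sum E x v = edge_sum E (\<lambda>v. b v * y v) v" for v
  proof (rule edge_sum_cong)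
    fix w assume "w \<in> {1..n}"
    then show "x w = b w * y w" using positiveD[OF b, of w] by (simp add: y_def)
  qed
  have row: "(r - ?d v) * y v ^ (k - 1) * b v ^ (k - 1) = edge_sum E (\<lambda>v. b v * y v) v"
    if "v \<in> {1..n}" for v
    using positiveD[OF x that] positiveD[OF b that]
    by (simp add: gap[OF that] xy[symmetric] b_prime_edge_sum power_divide y_def[of v])
  have Bb: "?B v * b v ^ (k - 1) = edge_sum E b v" if "v \<in> {1..n}" for v
    using positiveD[OF b that] by (simp add: b_prime_edge_sum)
  \<comment> \<open>Used twice: at \<open>v = i\<close> with \<open>w = j\<close>, where
    \<open>j\<close> is extremal among the neighbours of \<open>i\<close>, and at
    \<open>v = j\<close> with \<open>w = i\<close>, where \<open>i\<close> is extremal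
    overall.\<close>
  have step: "s * ((r - ?d v) * y v ^ (k - 1)) \<le> s * (?B v * y w ^ (k - 1))"
      "(r - ?d v) * y v ^ (k - 1) = ?B v * y w ^ (k - 1) \<Longrightarrow> e' \<in> E \<Longrightarrow> v \<in> e' \<Longrightarrow> u \<in> e' - {v} \<Longrightarrow> y u = y w"
    if v: "v \<in> {1..n}" and w: "w \<in> {1..n}"
      and le: "\<And>e u. e \<in> E \<Longrightarrow> v \<in> e \<Longrightarrow> u \<in> e - {v} \<Longrightarrow> s * y u \<le> s * y w" for v w e' u
  proof -
    note bound = signed_edge_sum_bound[where i = v, OF b y pos(3)[OF w] s]
    have "(s * ((r - ?d v) * y v ^ (k - 1))) * b v ^ (k - 1) \<le> (s * (?B v * y w ^ (k - 1))) * b v ^ (k - 1)"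
      using bound(1)[OF le] unfolding row[OF v, symmetric] Bb[OF v, symmetric] by (simp add: mult_ac)
    then show "s * ((r - ?d v) * y v ^ (k - 1)) \<le> s * (?B v * y w ^ (k - 1))"
      by (rule mult_right_le_imp_le) (use positiveD[OF b v] in simp)
    assume *: "(r - ?d v) * y v ^ (k - 1) = ?B v * y w ^ (k - 1)" "e' \<in> E" "v \<in> e'" "u \<in> e' - {v}"
    have "edge_sum E (\<lambda>v. b v * y v) v = y w ^ (k - 1) * edge_sum E b v"
      unfolding row[OF v, symmetric] Bb[OF v, symmetric] *(1) by simp
    from bound(2)[OF _ this *(2-4)] show "y u = y w" by (simp add: le)
  qed
  have le_i: "s * y u \<le> s * y j" if "e \<in> E" "i \<in> e" "u \<in> e - {i}" for e u
    using that by (intro jmax) (auto simp: N_def)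
  have le_j: "s * y u \<le> s * y i" if "e \<in> E" "j \<in> e" "u \<in> e - {j}" for e u
    using ext[of u] edge_vertex[of e u] that by (simp add: y_def)
  have signed: "s * (((r - ?d i) * y i ^ (k - 1)) * ((r - ?d j) * y j ^ (k - 1)))
      \<le> s * ((?B i * y j ^ (k - 1)) * (?B j * y i ^ (k - 1)))"
    and signed_eq: "s * ((?B i * y j ^ (k - 1)) * (?B j * y i ^ (k - 1)))
      \<le> s * (((r - ?d i) * y i ^ (k - 1)) * ((r - ?d j) * y j ^ (k - 1))) \<Longrightarrow>
      (r - ?d i) * y i ^ (k - 1) = ?B i * y j ^ (k - 1) \<and> (r - ?d j) * y j ^ (k - 1) = ?B j * y i ^ (k - 1)"
    by (rule signed_mult_mono[OF s]; use pos[OF i] pos[OF jn] step(1)[OF i jn le_i] step(1)[OF jn i le_j] in simp)+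
  \<comment> \<open>The positive factor common to both sides once the inequalities at
    \<open>i\<close> and \<open>j\<close> are multiplied.\<close>
  define c where "c = y i ^ (k - 1) * y j ^ (k - 1)"
  have c: "c > 0" using pos(3)[OF i] pos(3)[OF jn] by (simp add: c_def)
  have c1: "s * (((r - ?d i) * y i ^ (k - 1)) * ((r - ?d j) * y j ^ (k - 1))) = (s * ((r - ?d i) * (r - ?d j))) * c"
    and c2: "s * ((?B i * y j ^ (k - 1)) * (?B j * y i ^ (k - 1))) = (s * (?B i * ?B j)) * c"
    by (simp_all add: c_def mult_ac)
  have B: "0 \<le> ?B i * ?B j" using pos(2)[OF i] pos(2)[OF jn] by simp
  have roots: "r \<le> g_pair k E b i j \<longleftrightarrow> (r - ?d i) * (r - ?d j) \<le> ?B i * ?B j"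
    "g_pair k E b i j \<le> r \<longleftrightarrow> ?B i * ?B j \<le> (r - ?d i) * (r - ?d j)"
    using larger_root_iff[of "?d i" r "?d j" "?B i * ?B j"] pos(1)[OF i] pos(1)[OF jn] B
    by (simp_all add: g_pair_def mult.assoc)
  have g1: "s * r \<le> s * g_pair k E b i j \<longleftrightarrow> s * ((r - ?d i) * (r - ?d j)) \<le> s * (?B i * ?B j)"
    and g2: "s * g_pair k E b i j \<le> s * r \<longleftrightarrow> s * (?B i * ?B j) \<le> s * ((r - ?d i) * (r - ?d j))"
    using s roots by auto
  show ?thesis
  proof (rule that[OF e])
    show "s * r \<le> s * g_pair k E b i j"
      using signed c unfolding g1 c1 c2 by (rule mult_right_le_imp_le)
    assume "s * g_pair k E b i j \<le> s * r" and e': "e' \<in> E" "i \<in> e'" "v \<in> e'"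
    then have eqs: "(r - ?d i) * y i ^ (k - 1) = ?B i * y j ^ (k - 1)"
        "(r - ?d j) * y j ^ (k - 1) = ?B j * y i ^ (k - 1)"
      using signed_eq mult_right_mono[OF _ less_imp_le[OF c]] unfolding g2 c1 c2 by blast+
    \<comment> \<open>A common neighbour of \<open>i\<close> and \<open>j\<close>: equality at
      \<open>i\<close> gives it the value \<open>y j\<close>, equality at \<open>j\<close> the value
      \<open>y i\<close>.\<close>
    obtain w where w: "w \<in> e" "w \<noteq> i" "w \<noteq> j" using other_vertex_in_edge[OF e(1)] .
    have "y w = y j" by (rule step(2)[OF i jn _ eqs(1) e(1,2)]) (use w le_i in auto)
    moreover have "y w = y i" by (rule step(2)[OF jn i _ eqs(2) e(1,3)]) (use w le_j in auto)
    moreover have "y v = y j" if "v \<noteq> i"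
      by (rule step(2)[OF i jn _ eqs(1) e'(1,2)]) (use e'(3) that le_i in auto)
    ultimately show "x v / b v = x i / b i" unfolding y_def by metis
  qed
qed

text \<open>The first part applies \<open>extremal_vertex\<close> at a global extremum of
  \<open>x / b\<close>. If no pair beats \<open>r\<close>, the extremal vertices are closed under
  sharing an edge, so \<open>x\<close> is a multiple of \<open>b\<close> and scaling invariance
  gives \<open>b\<close> the row sums of \<open>x\<close>.\<close>

lemma signed_bound:
  assumes x: "positive x" and r: "\<And>i. i \<in> {1..n} \<Longrightarrow> row_sum x i = r"
    and b: "positive b" and s: "s = 1 \<or> s = - 1"
  shows "\<exists>e\<in>E. \<exists>(i, j)\<in>vertex_pairs e. s * r \<le> s * g_pair k E b i j"
    and "\<lbrakk>\<And>e i j. e \<in> E \<Longrightarrow> (i, j) \<in> vertex_pairs e \<Longrightarrow> s * g_pair k E b i j \<le> s * r; v \<in> {1..n}\<rbrakk>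
      \<Longrightarrow> row_sum b v = r"
proof -
  define y where "y v = x v / b v" for v
  have "Max ((\<lambda>v. s * y v) ` {1..n}) \<in> (\<lambda>v. s * y v) ` {1..n}" using n_pos by (intro Max_in) auto
  then obtain i where i: "i \<in> {1..n}" "s * y i = Max ((\<lambda>v. s * y v) ` {1..n})" by (elim imageE) (rule that; simp only:)
  have imax: "s * y v \<le> s * y i" if "v \<in> {1..n}" for v
    unfolding i(2) using that by (intro Max_ge) auto
  obtain e j where "e \<in> E" "i \<in> e" "j \<in> e" "i \<noteq> j" "s * r \<le> s * g_pair k E b i j"
    using extremal_vertex[OF x r b s i(1) imax[unfolded y_def]] by metis
  then show "\<exists>e\<in>E. \<exists>(i, j)\<in>vertex_pairs e. s * r \<le> s * g_pair k E b i j"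
    by (force simp: vertex_pairs_def)
  assume g: "\<And>e i j. e \<in> E \<Longrightarrow> (i, j) \<in> vertex_pairs e \<Longrightarrow> s * g_pair k E b i j \<le> s * r"
    and v: "v \<in> {1..n}"
  have const: "y u = y i" if "u \<in> {1..n}" for u
  proof (rule edge_induct[of i "\<lambda>u. y u = y i" u])
    fix e' p q assume e': "e' \<in> E" "p \<in> e'" "q \<in> e'" "y p = y i"
    have p: "p \<in> {1..n}" using edge_vertex e' by blast
    \<comment> \<open>As \<open>p\<close> has the same ratio as \<open>i\<close>, it is extremal
      too.\<close>
    have "s * (x u / b u) \<le> s * (x p / b p)" if "u \<in> {1..n}" for u
      using imax[OF that] e'(4) by (simp add: y_def)
    from extremal_vertex[OF x r b s p this, of e' q]
    obtain e j where e: "e \<in> E" "p \<in> e" "j \<in> e" "p \<noteq> j"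
      and *: "s * g_pair k E b p j \<le> s * r \<Longrightarrow> e' \<in> E \<Longrightarrow> p \<in> e' \<Longrightarrow> q \<in> e' \<Longrightarrow> x q / b q = x p / b p"
      by metis
    have "s * g_pair k E b p j \<le> s * r" using g[of e p j] e by (simp add: vertex_pairs_def)
    from *[OF this e'(1-3)] show "y q = y i" using e'(4) by (simp add: y_def)
  qed (use i that in auto)
  have "x u = y i * b u" if "u \<in> {1..n}" for u
    using const[OF that] positiveD[OF b that] by (simp add: y_def field_simps)
  then have "b_prime k E x v = b_prime k E (\<lambda>u. y i * b u) v" by (intro b_prime_cong v) auto
  moreover have "y i \<noteq> 0" using positiveD[OF x i(1)] positiveD[OF b i(1)] by (simp add: y_def)
  ultimately show "row_sum b v = r" using r[OF v] by (simp add: row_sum_def b_prime_scale)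
qed

section \<open>Minima and maxima over pairs in an edge\<close>

lemma finite_vertex_pairs: "e \<in> E \<Longrightarrow> finite (vertex_pairs e)"
  by (rule finite_subset[of _ "e \<times> e"]) (auto simp: vertex_pairs_def finite_edge)

lemma vertex_pairs_nonempty: "e \<in> E \<Longrightarrow> vertex_pairs e \<noteq> {}"
proof -
  assume e: "e \<in> E"
  obtain i where i: "i \<in> e" using other_vertex_in_edge[OF e] by blast
  obtain j where "j \<in> e" "j \<noteq> i" using other_vertex_in_edge[OF e] by metis
  then show ?thesis using i by (auto simp: vertex_pairs_def)
qed

lemma Min_pairs_le:
  assumes "e \<in> E" "(i, j) \<in> vertex_pairs e"
  shows "(MIN e\<in>E. MIN (i, j)\<in>vertex_pairs e. f i j) \<le> (f i j :: real)"
proof -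
  have "(MIN e\<in>E. MIN (i, j)\<in>vertex_pairs e. f i j) \<le> (MIN (i, j)\<in>vertex_pairs e. f i j)"
    using finite_edges assms by (intro Min_le) auto
  also have "\<dots> \<le> f i j"
    using finite_vertex_pairs assms by (intro Min_le) force+
  finally show ?thesis .
qed

lemma Max_pairs_ge:
  assumes "e \<in> E" "(i, j) \<in> vertex_pairs e"
  shows "(f i j :: real) \<le> (MAX e\<in>E. MAX (i, j)\<in>vertex_pairs e. f i j)"
proof -
  have "f i j \<le> (MAX (i, j)\<in>vertex_pairs e. f i j)"
    using finite_vertex_pairs assms by (intro Max_ge) force+
  also have "\<dots> \<le> (MAX e\<in>E. MAX (i, j)\<in>vertex_pairs e. f i j)"
    using finite_edges assms by (intro Max_ge) auto
  finally show ?thesis .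
qed

lemma Min_pairs_const:
  assumes "\<And>e i j. e \<in> E \<Longrightarrow> (i, j) \<in> vertex_pairs e \<Longrightarrow> f i j = (c :: real)"
  shows "(MIN e\<in>E. MIN (i, j)\<in>vertex_pairs e. f i j) = c"
proof -
  have "(\<lambda>(i, j). f i j) ` vertex_pairs e = {c}" if "e \<in> E" for e
    using vertex_pairs_nonempty[OF that] assms[OF that] by force
  then have "(\<lambda>e. MIN (i, j)\<in>vertex_pairs e. f i j) ` E = {c}"
    using nonempty by force
  then show ?thesis by simp
qed

end

theorem theorem3p6:
  fixes k n :: nat and E :: "nat set set" and b :: "nat \<Rightarrow> real"
  assumes "k \<ge> 3"
    and "uniform_hypergraph k n E"
    and "connected_hypergraph n E"
    and "E \<noteq> {}"
    and "\<And>i. i \<in> {1..n} \<Longrightarrow> b i > 0"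
  shows "(MIN e\<in>E. MIN (i, j)\<in>vertex_pairs e. g_pair k E b i j)
           \<le> tensor_spectral_radius k n (signless_laplacian_tensor k E)
       \<and> tensor_spectral_radius k n (signless_laplacian_tensor k E)
           \<le> (MAX e\<in>E. MAX (i, j)\<in>vertex_pairs e. g_pair k E b i j)
       \<and> ((MIN e\<in>E. MIN (i, j)\<in>vertex_pairs e. g_pair k E b i j)
             = tensor_spectral_radius k n (signless_laplacian_tensor k E)
           \<or> tensor_spectral_radius k n (signless_laplacian_tensor k E)
             = (MAX e\<in>E. MAX (i, j)\<in>vertex_pairs e. g_pair k E b i j)
         \<longleftrightarrow> (\<forall>i\<in>{1..n}. \<forall>j\<in>{1..n}.
               real (vertex_degree E i) + b_prime k E b i = real (vertex_degree E j) + b_prime k E b j))"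
proof -
  interpret connected_uniform_hypergraph k n E
    using assms by unfold_locales
  have b: "positive b" using assms(5) by (simp add: positive_def)
  obtain x r where x: "positive x" and r: "\<And>i. i \<in> {1..n} \<Longrightarrow> row_sum x i = r"
    using perron_vector by blast
  have rho: "tensor_spectral_radius k n (signless_laplacian_tensor k E) = r"
    using spectral_radius_eq[OF x] r by (simp add: row_sum_def)
  let ?min = "MIN e\<in>E. MIN (i, j)\<in>vertex_pairs e. g_pair k E b i j"
  let ?max = "MAX e\<in>E. MAX (i, j)\<in>vertex_pairs e. g_pair k E b i j"
  note upper = signed_bound[OF x r b, of 1, simplified]
    and lower = signed_bound[OF x r b, of "- 1", simplified]
  have "?min \<le> r"
    using lower(1) Min_pairs_le[of _ _ _ "g_pair k E b"] by (fastforce intro: order_trans)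
  moreover have "r \<le> ?max"
    using upper(1) Max_pairs_ge[of _ _ _ "g_pair k E b"] by (fastforce intro: order_trans)
  moreover have "\<forall>i\<in>{1..n}. \<forall>j\<in>{1..n}. row_sum b i = row_sum b j" if "?min = r \<or> r = ?max"
    using that
  proof
    assume "?min = r"
    then have "row_sum b v = r" if "v \<in> {1..n}" for v
      using signed_bound(2)[OF x r b, of "- 1" v] Min_pairs_le[of _ _ _ "g_pair k E b"] that by auto
    then show ?thesis by simp
  next
    assume "r = ?max"
    then have "row_sum b v = r" if "v \<in> {1..n}" for v
      using signed_bound(2)[OF x r b, of 1 v] Max_pairs_ge[of _ _ _ "g_pair k E b"] that by auto
    then show ?thesis by simp
  qed
  \<comment> \<open>If the rows of \<open>b\<close> agree, then \<open>b\<close> is itself a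
    positive eigenvector and the common row sum is \<open>r\<close>. Hence \<open>b_prime\<close>
    equals the gap between \<open>r\<close> and the degree, which makes \<open>r\<close> the larger
    root for every pair.\<close>
  moreover have "?min = r" if const: "\<forall>i\<in>{1..n}. \<forall>j\<in>{1..n}. row_sum b i = row_sum b j"
  proof (rule Min_pairs_const)
    obtain v where v: "v \<in> {1..n}" using n_pos by blast
    have c: "row_sum b i = row_sum b v" if "i \<in> {1..n}" for i using const that v by blast
    have "r = row_sum b v"
      using spectral_radius_eq[OF b] c rho by (simp add: row_sum_def)
    then have c: "row_sum b i = r" if "i \<in> {1..n}" for i using c[OF that] by simp
    fix e i j assume e: "e \<in> E" "(i, j) \<in> vertex_pairs e"
    then have ij: "i \<in> {1..n}" "j \<in> {1..n}" using edge_vertex by (auto simp: vertex_pairs_def)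
    have gap: "b_prime k E b v = r - real (vertex_degree E v)" "real (vertex_degree E v) < r"
      if "v \<in> {1..n}" for v
      using c[OF that] b_prime_pos[OF b that] by (auto simp: row_sum_def)
    show "g_pair k E b i j = r"
      using larger_root_iff[of "real (vertex_degree E i)" r "real (vertex_degree E j)"
          "b_prime k E b i * b_prime k E b j"] gap[OF ij(1)] gap[OF ij(2)]
      unfolding g_pair_def mult.assoc by (intro antisym) simp_all
  qed
  ultimately show ?thesis unfolding rho row_sum_def by blast
qed

end
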